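(* Let $\alpha$ be an umbra and let $\varphi_\alpha$ be the factorial umbra of $\alpha$. Then $$\alpha\equiv\varphi_\alpha.\beta,$$ where $\beta$ is the Bell umbra.
   Context: Umbral calculus: $R$ is a commutative integral domain whose quotient field has characteristic zero; $A$ is a set (alphabet) whose elements are called umbrae; $E:R[A]\to R$ is a linear functional (evaluation) with $E[1]=1$ and $E[\alpha^i\gamma^j\cdots\delta^k]=E[\alpha^i]E[\gamma^j]\cdots E[\delta^k]$ for distinct umbrae and nonnegative integers $i,j,\dots,k$. The moments of $\alpha$ are $a_n=E[\alpha^n]$; its generating function (g.f.) is the formal power series $f(t)=1+\sum_{n\ge1}a_n t^n/n!$. Two umbrae are similar, $\alpha\equiv\gamma$, if $E[\alpha^n]=E[\gamma^n]$ for all $n\ge0$, i.e. if they have the same g.f. The alphabet is assumed saturated, i.e. it contains sufficiently many distinct umbrae similar to any expression considered, so that the auxiliary umbrae below exist as umbrae; they are defined up to similarity by their g.f. Dot-product: if $\alpha$ has g.f. $f(t)$ and $\gamma$ has g.f. $g(t)$, then $\gamma.\alpha$ is an auxiliary umbra with g.f. $g[\log f(t)]$. Bell umbra $\beta$: the umbra with $E[\beta(\beta-1)\cdots(\beta-n+1)]=1$ for all $n\ge0$; its g.f. is $\exp(e^t-1)$. Singleton umbra $\chi$: $E[\chi^n]=\delta_{1,n}$ for $n\ge1$; its g.f. is $1+t$. Factorial umbra: an umbra $\varphi_\alpha$ is an $\alpha$-factorial umbra (factorial umbra of $\alpha$) if $\varphi_\alpha\equiv\alpha.\chi$. *)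

theory Defs
  imports
    "HOL-Library.Poly_Mapping"
    "HOL-Computational_Algebra.Formal_Power_Series"
    "HOL-Computational_Algebra.Fraction_Field"
begin

text \<open>
  The library has no instance making the quotient field of a characteristic-zero domain a
  field of characteristic zero; generating functions need it for division by factorials
  and for the logarithmic series.
\<close>

instance fract :: ("{idom, ring_char_0}") field_char_0
proof
  have of_nat_Fract: "(of_nat n :: 'a fract) = Fraction_Field.Fract (of_nat n) 1" for n
    by (induction n) (auto simp: Fraction_Field.Zero_fract_def Fraction_Field.One_fract_def)
  show "inj (of_nat :: nat \<Rightarrow> 'a fract)"
    by (rule injI) (simp add: of_nat_Fract Fraction_Field.eq_fract)
qed

text \<open>
  The alphabet is a type \<open>'a\<close>, and \<open>R[A]\<close> is represented by finitely supported maps from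
  monomials (finitely supported exponent functions) to coefficients.
\<close>

type_synonym ('a, 'r) umbral_poly = "('a \<Rightarrow>\<^sub>0 nat) \<Rightarrow>\<^sub>0 'r"

definition umbra :: "'a \<Rightarrow> ('a, 'r::comm_ring_1) umbral_poly" where
  "umbra \<alpha> = Poly_Mapping.single (Poly_Mapping.single \<alpha> 1) 1"

definition const_poly :: "'r \<Rightarrow> ('a, 'r::comm_ring_1) umbral_poly" where
  "const_poly c = Poly_Mapping.single 0 c"

locale umbral_calculus =
  fixes E :: "('a, 'r::{idom, ring_char_0}) umbral_poly \<Rightarrow> 'r"
  assumes eval_add: "E (p + q) = E p + E q"
    and eval_scale: "E (const_poly c * p) = c * E p"
    and eval_one: "E 1 = 1"
    and eval_uncorrelated:
      "finite S \<Longrightarrow> E (\<Prod>\<alpha>\<in>S. umbra \<alpha> ^ k \<alpha>) = (\<Prod>\<alpha>\<in>S. E (umbra \<alpha> ^ k \<alpha>))"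

definition moment :: "(('a, 'r::{idom, ring_char_0}) umbral_poly \<Rightarrow> 'r) \<Rightarrow> 'a \<Rightarrow> nat \<Rightarrow> 'r" where
  "moment E \<alpha> n = E (umbra \<alpha> ^ n)"

definition similar :: "(('a, 'r::{idom, ring_char_0}) umbral_poly \<Rightarrow> 'r) \<Rightarrow> 'a \<Rightarrow> 'a \<Rightarrow> bool" where
  "similar E \<alpha> \<gamma> \<longleftrightarrow> (\<forall>n. moment E \<alpha> n = moment E \<gamma> n)"

text \<open>Because of the factorials, generating functions live over the quotient field of \<open>R\<close>.\<close>

definition gen_fun :: "(('a, 'r::{idom, ring_char_0}) umbral_poly \<Rightarrow> 'r) \<Rightarrow> 'a \<Rightarrow> 'r fract fps" where
  "gen_fun E \<alpha> = Abs_fps (\<lambda>n. Fraction_Field.Fract (moment E \<alpha> n) 1 / fact n)"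

text \<open>
  Here \<open>fps_ln 1\<close> is the series of \<open>log (1 + t)\<close>, so \<open>log f(t)\<close> for a series with constant
  term 1 is obtained by substituting \<open>f(t) - 1\<close>.
\<close>

definition fps_log :: "'b::field_char_0 fps \<Rightarrow> 'b fps" where
  "fps_log f = fps_ln 1 oo (f - 1)"

definition is_dot_product ::
  "(('a, 'r::{idom, ring_char_0}) umbral_poly \<Rightarrow> 'r) \<Rightarrow> 'a \<Rightarrow> 'a \<Rightarrow> 'a \<Rightarrow> bool" where
  "is_dot_product E \<gamma> \<alpha> \<delta> \<longleftrightarrow> gen_fun E \<delta> = gen_fun E \<gamma> oo fps_log (gen_fun E \<alpha>)"

text \<open>
  Dot-products are the only auxiliary umbrae considered, so saturation is required of them
  only, as the existence of a representing umbra. Such an umbra is determined up to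
  similarity, and \<open>dot E \<gamma> \<alpha>\<close>, i.e. \<open>\<gamma>.\<alpha>\<close>, is an arbitrary choice of one.
\<close>

locale saturated_umbral_calculus = umbral_calculus E
  for E :: "('a, 'r::{idom, ring_char_0}) umbral_poly \<Rightarrow> 'r" +
  assumes ex_dot_product: "\<exists>\<delta>. is_dot_product E \<gamma> \<alpha> \<delta>"

definition dot :: "(('a, 'r::{idom, ring_char_0}) umbral_poly \<Rightarrow> 'r) \<Rightarrow> 'a \<Rightarrow> 'a \<Rightarrow> 'a" where
  "dot E \<gamma> \<alpha> = (SOME \<delta>. is_dot_product E \<gamma> \<alpha> \<delta>)"

definition bell_umbra :: "(('a, 'r::{idom, ring_char_0}) umbral_poly \<Rightarrow> 'r) \<Rightarrow> 'a \<Rightarrow> bool" where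
  "bell_umbra E \<beta> \<longleftrightarrow> (\<forall>n. E (\<Prod>i<n. umbra \<beta> - of_nat i) = 1)"

definition singleton_umbra :: "(('a, 'r::{idom, ring_char_0}) umbral_poly \<Rightarrow> 'r) \<Rightarrow> 'a \<Rightarrow> bool" where
  "singleton_umbra E \<chi> \<longleftrightarrow> (\<forall>n\<ge>1. moment E \<chi> n = (if n = 1 then 1 else 0))"

definition factorial_umbra ::
  "(('a, 'r::{idom, ring_char_0}) umbral_poly \<Rightarrow> 'r) \<Rightarrow> 'a \<Rightarrow> 'a \<Rightarrow> bool" where
  "factorial_umbra E \<alpha> \<phi> \<longleftrightarrow> (\<exists>\<chi>. singleton_umbra E \<chi> \<and> similar E \<phi> (dot E \<alpha> \<chi>))"

end

theory Submission
  imports Defs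
begin

text \<open>
  Since \<open>\<chi>\<close> has g.f. \<open>1 + t\<close>, the g.f. of \<open>\<phi>\<close> is \<open>f(log(1 + t))\<close>, where \<open>f\<close> is the g.f. of \<open>\<alpha>\<close>.
  Expanding \<open>(\<beta> - k)\<^sup>n\<close> around \<open>k + 1\<close> shows that \<open>E[(\<beta> - k)\<^sup>n (\<beta>)\<^sub>k]\<close> does not depend on \<open>k\<close>, which
  gives the recurrence \<open>b\<^sub>n\<^sub>+\<^sub>1 = \<Sum>\<^sub>j (n choose j) b\<^sub>j\<close> for the moments of \<open>\<beta>\<close>. So the g.f. \<open>G\<close> of \<open>\<beta>\<close>
  satisfies \<open>G' = e\<^sup>t G\<close>, hence \<open>log G = e\<^sup>t - 1\<close>, and the g.f. of \<open>\<phi>.\<beta>\<close> is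
  \<open>f(log(1 + (e\<^sup>t - 1))) = f\<close>.
\<close>

lemma fps_ln_oo_exp_minus_one: "fps_ln 1 oo (fps_exp 1 - 1) = (fps_X :: 'b::field_char_0 fps)"
proof -
  have "fps_ln 1 = fps_inv (fps_exp 1 - 1 :: 'b fps)"
    using fps_ln_fps_exp_inv[of "1::'b"] by simp
  then show ?thesis
    by (simp add: fps_inv)
qed

lemma fps_log_one_plus_X: "fps_log (1 + fps_X) = (fps_ln 1 :: 'b::field_char_0 fps)"
  by (simp add: fps_log_def)

text \<open>Chain rule: log(1 + t) has derivative 1/(1 + t), which becomes 1/f on substituting
  \<open>f - 1\<close> for t.\<close>

lemma fps_deriv_fps_log:
  fixes f :: "'b::field_char_0 fps"
  assumes "fps_nth f 0 = 1"
  shows "fps_deriv (fps_log f) = fps_deriv f / f"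
proof -
  have "(1 + fps_X) oo (f - 1) = f"
    using assms by (simp add: fps_compose_add_distrib)
  then have "inverse (1 + fps_X) oo (f - 1) = inverse f"
    using assms by (simp add: fps_inverse_compose)
  then show ?thesis
    using assms
    by (simp add: fps_log_def fps_compose_deriv fps_ln_deriv fps_divide_unit mult.commute)
qed

text \<open>By hypothesis f'/f = e^t, so both sides have the same derivative, and both have constant
  term 0.\<close>

lemma fps_log_eq_exp_minus_one:
  fixes f :: "'b::field_char_0 fps"
  assumes "fps_nth f 0 = 1" and "fps_deriv f = fps_exp 1 * f"
  shows "fps_log f = fps_exp 1 - 1"
proof -
  have "fps_deriv (fps_log f) = fps_deriv (fps_exp 1 - 1)"
    using assms by (auto simp: fps_deriv_fps_log)
  moreover have "fps_nth (fps_log f) 0 = fps_nth (fps_exp 1 - 1) 0"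
    by (simp add: fps_log_def fps_ln_def)
  ultimately show ?thesis
    unfolding fps_deriv_eq_iff by simp
qed

text \<open>\<open>Fract x 1\<close> embeds R into its quotient field. The embedding is distributed
  over sums, opposite to the orientation of \<open>add_fract\<close>, hence the removal of that rule
  in the next two lemmas.\<close>

lemma Fract_one_add:
  "Fraction_Field.Fract (x + y) 1 = Fraction_Field.Fract x 1 + Fraction_Field.Fract (y::'r::idom) 1"
  by simp

lemma Fract_one_of_nat_mult:
  "Fraction_Field.Fract (of_nat n * x) 1 = of_nat n * Fraction_Field.Fract (x::'r::idom) 1"
  by (induction n)
    (simp_all add: Fract_one_add distrib_right del: Fraction_Field.add_fract
      flip: Fraction_Field.Zero_fract_def)

lemma Fract_one_sum:
  "Fraction_Field.Fract (\<Sum>i\<in>S. h i) 1 = (\<Sum>i\<in>S. Fraction_Field.Fract (h i :: 'r::idom) 1)"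
  by (induction S rule: infinite_finite_induct)
    (simp_all add: Fract_one_add del: Fraction_Field.add_fract
      flip: Fraction_Field.Zero_fract_def)

text \<open>The embedding of R is injective and factorials are nonzero, so the g.f. determines the
  moments.\<close>

lemma similar_iff_gen_fun_eq: "similar E \<alpha> \<gamma> \<longleftrightarrow> gen_fun E \<alpha> = gen_fun E \<gamma>"
  by (simp add: similar_def gen_fun_def fps_eq_iff Fraction_Field.eq_fract)

context umbral_calculus
begin

lemma moment_0 [simp]: "moment E \<alpha> 0 = 1"
  by (simp add: moment_def eval_one)

lemma gen_fun_nth_0 [simp]: "fps_nth (gen_fun E \<alpha>) 0 = 1"
  by (simp add: gen_fun_def Fraction_Field.One_fract_def)

lemma eval_zero [simp]: "E 0 = 0"
  using eval_add[of 0 0] by simp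

lemma eval_of_nat_mult: "E (of_nat n * p) = of_nat n * E p"
  by (induction n) (simp_all add: distrib_right eval_add)

lemma eval_sum: "E (\<Sum>i\<in>S. h i) = (\<Sum>i\<in>S. E (h i))"
  by (induction S rule: infinite_finite_induct) (simp_all add: eval_add)

lemma gen_fun_singleton:
  assumes "singleton_umbra E \<chi>"
  shows "gen_fun E \<chi> = 1 + fps_X"
proof (rule fps_ext)
  fix n :: nat
  \<comment> \<open>\<open>singleton_umbra\<close> prescribes only moments from 1 on; moment 0 comes
    from E[1] = 1.\<close>
  have "n = 0 \<or> n = 1 \<or> n \<ge> 2" by auto
  then show "fps_nth (gen_fun E \<chi>) n = fps_nth (1 + fps_X) n"
    using assms
    using Fraction_Field.Zero_fract_def[where 'a = 'r] Fraction_Field.One_fract_def[where 'a = 'r]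
    by (elim disjE) (simp_all add: singleton_umbra_def gen_fun_def)
qed

lemma eval_shifted_power_falling_factorial:
  assumes "bell_umbra E \<beta>"
  shows "E ((umbra \<beta> - of_nat k) ^ n * (\<Prod>i<k. umbra \<beta> - of_nat i)) = moment E \<beta> n"
proof -
  let ?x = "umbra \<beta> :: ('a, 'r) umbral_poly"
  define F where "F n k = E ((?x - of_nat k) ^ n * (\<Prod>i<k. ?x - of_nat i))" for n k
  \<comment> \<open>One factor \<beta> - k of the power extends the falling factorial; only the
    other n factors are expanded.\<close>
  have F_Suc: "F (Suc n) k = (\<Sum>j\<le>n. of_nat (n choose j) * F j (Suc k))" for n k
  proof -
    have "(?x - of_nat k) ^ n
        = (\<Sum>j\<le>n. of_nat (n choose j) * (?x - of_nat (Suc k)) ^ j)"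
      using binomial_ring[of "?x - of_nat (Suc k)" 1 n] by simp
    moreover have "(?x - of_nat k) ^ Suc n * (\<Prod>i<k. ?x - of_nat i)
        = (?x - of_nat k) ^ n * (\<Prod>i<Suc k. ?x - of_nat i)"
      by (simp add: mult_ac)
    ultimately have "(?x - of_nat k) ^ Suc n * (\<Prod>i<k. ?x - of_nat i)
        = (\<Sum>j\<le>n. of_nat (n choose j) *
            ((?x - of_nat (Suc k)) ^ j * (\<Prod>i<Suc k. ?x - of_nat i)))"
      by (simp only: sum_distrib_right mult.assoc)
    then show ?thesis
      by (simp only: F_def eval_sum eval_of_nat_mult)
  qed
  have "F n k = F n 0" for n k
  proof (induction n arbitrary: k rule: less_induct)
    case (less n)
    show ?case
    proof (cases n)
      case 0
      then show ?thesis
        using assms by (simp add: F_def bell_umbra_def eval_one)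
    next
      case (Suc m)
      \<comment> \<open>\<open>F_Suc\<close> raises the second index of \<open>F n k\<close> and of
        \<open>F n 0\<close> alike, so the induction hypothesis is needed at \<open>Suc k\<close>
        and at \<open>Suc 0\<close>.\<close>
      have "F j (Suc k) = F j (Suc 0)" if "j \<le> m" for j
        using less.IH[of j "Suc k"] less.IH[of j "Suc 0"] that Suc by simp
      then show ?thesis
        by (simp add: Suc F_Suc)
    qed
  qed
  from this[of n k] show ?thesis
    by (simp add: F_def moment_def)
qed

lemma bell_moment_Suc:
  assumes "bell_umbra E \<beta>"
  shows "moment E \<beta> (Suc n) = (\<Sum>j\<le>n. of_nat (n choose j) * moment E \<beta> j)"
proof -
  let ?x = "umbra \<beta> :: ('a, 'r) umbral_poly"
  have "?x ^ Suc n = (\<Sum>j\<le>n. of_nat (n choose j) * ((?x - 1) ^ j * ?x))"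
    using arg_cong[OF binomial_ring[of "?x - 1" 1 n], of "\<lambda>p. p * ?x"]
    by (simp add: sum_distrib_right mult.assoc power_Suc2 del: power_Suc)
  \<comment> \<open>For k = 1 the falling factorial is \<beta> itself.\<close>
  moreover have "E ((umbra \<beta> - 1) ^ j * umbra \<beta>) = moment E \<beta> j" for j
    using eval_shifted_power_falling_factorial[OF assms, of 1 j] by simp
  ultimately show ?thesis
    by (simp add: moment_def[of _ _ "Suc n"] eval_sum eval_of_nat_mult del: power_Suc)
qed

lemma gen_fun_bell_deriv:
  assumes "bell_umbra E \<beta>"
  shows "fps_deriv (gen_fun E \<beta>) = fps_exp 1 * gen_fun E \<beta>"
proof (rule fps_ext)
  fix n
  let ?b = "\<lambda>j. Fraction_Field.Fract (moment E \<beta> j) 1"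
  have "fps_nth (fps_deriv (gen_fun E \<beta>)) n = ?b (Suc n) / fact n"
    by (simp add: gen_fun_def divide_simps del: of_nat_Suc)
  also have "\<dots> = (\<Sum>j\<le>n. of_nat (n choose j) * ?b j) / fact n"
    by (simp add: bell_moment_Suc[OF assms] Fract_one_sum Fract_one_of_nat_mult)
  \<comment> \<open>Since (n choose j)/n! = 1/(j! (n - j)!), the recurrence becomes a Cauchy product
    with e^t.\<close>
  also have "\<dots> = (\<Sum>j\<le>n. ?b j / fact j * (1 / fact (n - j)))"
    unfolding sum_divide_distrib by (intro sum.cong) (auto simp: binomial_fact)
  also have "\<dots> = fps_nth (gen_fun E \<beta> * fps_exp 1) n"
    by (simp add: fps_mult_nth gen_fun_def atLeast0AtMost)
  finally show "fps_nth (fps_deriv (gen_fun E \<beta>)) n = fps_nth (fps_exp 1 * gen_fun E \<beta>) n"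
    by (simp add: mult.commute)
qed

lemma fps_log_gen_fun_bell:
  assumes "bell_umbra E \<beta>"
  shows "fps_log (gen_fun E \<beta>) = fps_exp 1 - 1"
  by (intro fps_log_eq_exp_minus_one gen_fun_bell_deriv assms gen_fun_nth_0)

end

text \<open>Saturation makes the choice in \<open>dot\<close> meaningful.\<close>

lemma (in saturated_umbral_calculus) gen_fun_dot:
  "gen_fun E (dot E \<gamma> \<alpha>) = gen_fun E \<gamma> oo fps_log (gen_fun E \<alpha>)"
  using someI_ex[OF ex_dot_product] unfolding dot_def is_dot_product_def .

theorem theorem5p11:
  fixes E :: "('a, 'r::{idom, ring_char_0}) umbral_poly \<Rightarrow> 'r"
    and \<alpha> \<phi> \<beta> :: 'a
  assumes "saturated_umbral_calculus E"
    and "bell_umbra E \<beta>"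
    and "factorial_umbra E \<alpha> \<phi>"
  shows "similar E \<alpha> (dot E \<phi> \<beta>)"
proof -
  interpret saturated_umbral_calculus E by fact
  obtain \<chi> where "singleton_umbra E \<chi>" and "gen_fun E \<phi> = gen_fun E (dot E \<alpha> \<chi>)"
    using assms(3) by (auto simp: factorial_umbra_def similar_iff_gen_fun_eq)
  then have "gen_fun E \<phi> = gen_fun E \<alpha> oo fps_ln 1"
    by (simp add: gen_fun_dot gen_fun_singleton fps_log_one_plus_X)
  then have "gen_fun E (dot E \<phi> \<beta>) = (gen_fun E \<alpha> oo fps_ln 1) oo (fps_exp 1 - 1)"
    by (simp add: gen_fun_dot fps_log_gen_fun_bell[OF assms(2)])
  \<comment> \<open>Composition is associative here because log(1 + t) and e^t - 1 have no constant
    term.\<close>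
  also have "\<dots> = gen_fun E \<alpha> oo (fps_ln 1 oo (fps_exp 1 - 1))"
    by (rule fps_compose_assoc[symmetric]) (simp_all add: fps_ln_def)
  also have "\<dots> = gen_fun E \<alpha>"
    by (simp add: fps_ln_oo_exp_minus_one)
  finally show ?thesis
    by (simp add: similar_iff_gen_fun_eq)
qed

end
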